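(* Let $\bar B\in\mathbb{R}^{n\times p}$ be a matrix with $\operatorname{rank}(\bar B)=r<n$, and let $\bar B=UDV^*$ be its singular value decomposition, with the singular values in decreasing order. Let $U_{r:n}$ denote the matrix of the last $n-r$ columns of $U$, and define $$B_{augmented}=\begin{bmatrix}\bar B & U_{r:n}\end{bmatrix}\in\mathbb{R}^{n\times(p+n-r)},\qquad P=B_{augmented}^T\left(B_{augmented}B_{augmented}^T\right)^{-1}.$$ Then the matrix $\bar B^\dagger$ formed by the first $p$ rows of $P$ is the (Moore–Penrose) pseudo inverse of $\bar B$.
   Context: $U\in\mathbb{R}^{n\times n}$ and $V\in\mathbb{R}^{p\times p}$ are orthogonal and $D\in\mathbb{R}^{n\times p}$ is diagonal with nonnegative, decreasingly ordered diagonal entries. *)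

theory Defs
  imports "Jordan_Normal_Form.DL_Rank" "Jordan_Normal_Form.Gauss_Jordan_Elimination"
begin

text \<open>The predicate \<^const>\<open>orthogonal_mat\<close> only asks for pairwise orthogonal nonzero columns; here
  the columns have to be orthonormal.\<close>

definition real_orthogonal_mat :: "nat \<Rightarrow> real mat \<Rightarrow> bool" where
  "real_orthogonal_mat n U \<longleftrightarrow>
     U \<in> carrier_mat n n \<and> transpose_mat U * U = 1\<^sub>m n \<and> U * transpose_mat U = 1\<^sub>m n"

definition is_svd :: "real mat \<Rightarrow> real mat \<Rightarrow> real mat \<Rightarrow> real mat \<Rightarrow> bool" where
  "is_svd A U D V \<longleftrightarrow>
     real_orthogonal_mat (dim_row A) U \<and>
     real_orthogonal_mat (dim_col A) V \<and>
     D \<in> carrier_mat (dim_row A) (dim_col A) \<and>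
     diagonal_mat D \<and>
     (\<forall>i < min (dim_row A) (dim_col A). 0 \<le> D $$ (i, i)) \<and>
     (\<forall>i j. i \<le> j \<longrightarrow> j < min (dim_row A) (dim_col A) \<longrightarrow> D $$ (j, j) \<le> D $$ (i, i)) \<and>
     A = U * D * transpose_mat V"

definition append_cols :: "'a :: zero mat \<Rightarrow> 'a mat \<Rightarrow> 'a mat" (infixr \<open>@\<^sub>c\<close> 65) where
  "A @\<^sub>c B = four_block_mat A B (0\<^sub>m 0 (dim_col A)) (0\<^sub>m 0 (dim_col B))"

text \<open>Columns are numbered from 0, so dropping \<open>r\<close> of them leaves the last \<open>dim_col U - r\<close>.\<close>

definition drop_cols :: "nat \<Rightarrow> 'a mat \<Rightarrow> 'a mat" where
  "drop_cols r U = mat_of_cols (dim_row U) (drop r (cols U))"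

definition take_rows :: "nat \<Rightarrow> 'a mat \<Rightarrow> 'a mat" where
  "take_rows k A = mat_of_rows (dim_col A) (take k (rows A))"

text \<open>The four Penrose conditions.\<close>

definition is_pseudo_inverse :: "real mat \<Rightarrow> real mat \<Rightarrow> bool" where
  "is_pseudo_inverse A X \<longleftrightarrow>
     X \<in> carrier_mat (dim_col A) (dim_row A) \<and>
     A * X * A = A \<and>
     X * A * X = X \<and>
     transpose_mat (A * X) = A * X \<and>
     transpose_mat (X * A) = X * A"

text \<open>A matrix satisfying them is \<^emph>\<open>the\<close> pseudo inverse.\<close>

lemma is_pseudo_inverse_unique:
  assumes X: "is_pseudo_inverse A X" and Y: "is_pseudo_inverse A Y"
  shows "X = Y"
proof -
  obtain n p where A: "A \<in> carrier_mat n p" by blast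
  have cX: "X \<in> carrier_mat p n" and cY: "Y \<in> carrier_mat p n"
    using X Y A by (auto simp: is_pseudo_inverse_def)
  have eqX: "A * X * A = A" "X * A * X = X" "transpose_mat (A * X) = A * X"
      "transpose_mat (X * A) = X * A"
    and eqY: "A * Y * A = A" "Y * A * Y = Y" "transpose_mat (A * Y) = A * Y"
      "transpose_mat (Y * A) = Y * A"
    using X Y by (auto simp: is_pseudo_inverse_def)
  have AX: "A * X \<in> carrier_mat n n" and AY: "A * Y \<in> carrier_mat n n"
    and XA: "X * A \<in> carrier_mat p p" and YA: "Y * A \<in> carrier_mat p p"
    using A cX cY by auto
  have "(A * Y) * (A * X) = A * X"
    using assoc_mult_mat[OF AY A cX] eqY(1) by simp
  then have "transpose_mat (A * X) * transpose_mat (A * Y) = transpose_mat (A * X)"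
    using transpose_mult[OF AY AX] by simp
  then have "(A * X) * (A * Y) = A * X" using eqX(3) eqY(3) by simp
  moreover have "(A * X) * (A * Y) = A * Y"
    using assoc_mult_mat[OF AX A cY] eqX(1) by simp
  ultimately have 1: "A * X = A * Y" by simp
  have "(X * A) * (Y * A) = X * A"
    using assoc_mult_mat[OF cX A YA] assoc_mult_mat[OF A cY A] eqY(1) by simp
  then have "transpose_mat (Y * A) * transpose_mat (X * A) = transpose_mat (X * A)"
    using transpose_mult[OF XA YA] by simp
  then have "(Y * A) * (X * A) = X * A" using eqX(4) eqY(4) by simp
  moreover have "(Y * A) * (X * A) = Y * A"
    using assoc_mult_mat[OF cY A XA] assoc_mult_mat[OF A cX A] eqX(1) by simp
  ultimately have 2: "X * A = Y * A" by simp
  have "X = Y * A * X" using eqX(2) 2 by simp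
  also have "\<dots> = Y * (A * Y)" using assoc_mult_mat[OF cY A cX] 1 by simp
  also have "\<dots> = Y" using assoc_mult_mat[OF cY A cY] eqY(2) by simp
  finally show ?thesis .
qed

end

theory Submission
  imports Defs
begin

text \<open>If \<open>r\<close> is the rank, then the nonzero singular values are \<open>d\<^sub>0, \<dots>, d\<^sub>r\<^sub>-\<^sub>1\<close>, and
  \<open>B\<^sub>a\<^sub>u\<^sub>g B\<^sub>a\<^sub>u\<^sub>g\<^sup>T = U S U\<^sup>T\<close> with \<open>S = diag (d\<^sub>0\<^sup>2, \<dots>, d\<^sub>r\<^sub>-\<^sub>1\<^sup>2, 1, \<dots>, 1)\<close>:
  the appended columns of \<open>U\<close> fill up exactly the kernel of \<open>B B\<^sup>T\<close>. The first \<open>p\<close> rows of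
  \<open>P\<close> are therefore \<open>B\<^sup>T U S\<^sup>-\<^sup>1 U\<^sup>T = V (D\<^sup>T S\<^sup>-\<^sup>1) U\<^sup>T\<close>, where \<open>D\<^sup>T S\<^sup>-\<^sup>1\<close> is the pseudo inverse
  of \<open>D\<close>.\<close>

section \<open>Rectangular diagonal matrices\<close>

text \<open>A function instead of a list of entries lets the same \<open>d\<close> describe a
  diagonal of any shape. The singular value matrix, its transpose, its truncations and square
  weights can then be multiplied pointwise.\<close>

definition rect_diag :: "nat \<Rightarrow> nat \<Rightarrow> (nat \<Rightarrow> 'a :: zero) \<Rightarrow> 'a mat" where
  "rect_diag m n f = mat m n (\<lambda>(i, j). if i = j then f i else 0)"

lemma rect_diag_carrier [simp]: "rect_diag m n f \<in> carrier_mat m n"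
  by (simp add: rect_diag_def)

lemma dim_rect_diag [simp]: "dim_row (rect_diag m n f) = m" "dim_col (rect_diag m n f) = n"
  by (simp_all add: rect_diag_def)

lemma rect_diag_cong:
  assumes "\<And>i. i < m \<Longrightarrow> i < n \<Longrightarrow> f i = g i"
  shows "rect_diag m n f = rect_diag m n g"
  using assms by (intro eq_matI) (auto simp: rect_diag_def)

lemma rect_diag_transpose [simp]: "transpose_mat (rect_diag m n f) = rect_diag n m f"
  by (intro eq_matI) (auto simp: rect_diag_def)

lemma rect_diag_one: "1\<^sub>m n = rect_diag n n (\<lambda>_. 1)"
  by (intro eq_matI) (auto simp: rect_diag_def)

lemma rect_diag_add:
  fixes f g :: "nat \<Rightarrow> 'a :: monoid_add"
  shows "rect_diag m n f + rect_diag m n g = rect_diag m n (\<lambda>i. f i + g i)"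
  by (intro eq_matI) (auto simp: rect_diag_def)

text \<open>The guard \<open>i < b\<close> matters when the inner dimension is the smallest: passing
  through it cuts the diagonal off at \<open>b\<close>. Both the rank factorization and
  \<open>B * transpose_mat B\<close> with \<open>p < n\<close> rely on this.\<close>

lemma rect_diag_mult:
  fixes f g :: "nat \<Rightarrow> 'a :: semiring_0"
  shows "rect_diag a b f * rect_diag b c g = rect_diag a c (\<lambda>i. if i < b then f i * g i else 0)"
proof (rule eq_matI)
  fix i j assume "i < dim_row (rect_diag a c (\<lambda>i. if i < b then f i * g i else 0))"
    "j < dim_col (rect_diag a c (\<lambda>i. if i < b then f i * g i else 0))"
  then have ij: "i < a" "j < c" by auto
  have "(rect_diag a b f * rect_diag b c g) $$ (i, j) =
      (\<Sum>k = 0..<b. (if i = k then f i else 0) * (if k = j then g k else 0))"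
    using ij by (simp add: rect_diag_def scalar_prod_def)
  also have "\<dots> = (\<Sum>k = 0..<b. if k = i then (if i = j then f i * g i else 0) else 0)"
    by (rule sum.cong) auto
  also have "\<dots> = rect_diag a c (\<lambda>i. if i < b then f i * g i else 0) $$ (i, j)"
    using ij by (simp add: rect_diag_def)
  finally show "(rect_diag a b f * rect_diag b c g) $$ (i, j) =
      rect_diag a c (\<lambda>i. if i < b then f i * g i else 0) $$ (i, j)" .
qed auto

lemma diagonal_mat_eq_rect_diag:
  assumes "diagonal_mat D" "D \<in> carrier_mat n p"
  shows "D = rect_diag n p (\<lambda>i. D $$ (i, i))"
  using assms by (intro eq_matI) (auto simp: rect_diag_def diagonal_mat_def)

text \<open>Zero entries are covered by the convention \<open>inverse 0 = 0\<close>.\<close>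

lemma is_pseudo_inverse_rect_diag:
  "is_pseudo_inverse (rect_diag n p d) (rect_diag p n (\<lambda>i. inverse (d i)))"
proof -
  have "x * inverse x * x = x" "inverse x * x * inverse x = inverse x" for x :: real
    by (cases "x = 0"; simp)+
  then show ?thesis
    unfolding is_pseudo_inverse_def by (auto simp: rect_diag_mult intro!: rect_diag_cong)
qed

section \<open>Orthogonal factors\<close>

text \<open>Side conditions on dimensions contain no variables beyond those of the product, unlike
  carrier premises, so the equation works as a conditional rewrite rule.\<close>

lemma assoc_mult_mat_dim:
  "dim_col A = dim_row B \<Longrightarrow> dim_col B = dim_row C \<Longrightarrow>
    (A * B) * C = A * (B * C :: 'a :: semiring_0 mat)"
  by (metis assoc_mult_mat carrier_mat_triv)

lemma transpose_mult_dim: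
  "dim_col A = dim_row B \<Longrightarrow>
    transpose_mat (A * B) = transpose_mat B * transpose_mat (A :: 'a :: comm_semiring_0 mat)"
  by (metis transpose_mult carrier_mat_triv)

text \<open>The inner \<open>transpose_mat V * V\<close> collapses. As all matrices below are kept
  in the form \<open>U * X * transpose_mat V\<close>, every product reduces to one of the middle
  factors.\<close>

lemma mult_orthogonal_cancel:
  fixes U :: "'a :: comm_ring_1 mat"
  assumes "U \<in> carrier_mat a b" "X \<in> carrier_mat b c" "V \<in> carrier_mat c c"
    "Y \<in> carrier_mat c d" "W \<in> carrier_mat e d" and V: "transpose_mat V * V = 1\<^sub>m c"
  shows "(U * X * transpose_mat V) * (V * Y * transpose_mat W) = U * (X * Y) * transpose_mat W"
proof -
  have "(U * X * transpose_mat V) * (V * Y * transpose_mat W) =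
      U * (X * ((transpose_mat V * V) * (Y * transpose_mat W)))"
    using assms(1-5) by (auto simp: assoc_mult_mat_dim)
  also have "\<dots> = U * (X * Y) * transpose_mat W"
    using assms(1-5) by (auto simp: V assoc_mult_mat_dim)
  finally show ?thesis .
qed

lemma transpose_mult3:
  fixes U :: "'a :: comm_ring_1 mat"
  assumes "U \<in> carrier_mat a b" "X \<in> carrier_mat b c" "V \<in> carrier_mat d c"
  shows "transpose_mat (U * X * transpose_mat V) = V * transpose_mat X * transpose_mat U"
  using assms by (auto simp: transpose_mult_dim assoc_mult_mat_dim)

text \<open>The two mixed products are \<open>D * X\<close> conjugated by \<open>U\<close> and
  \<open>X * D\<close> conjugated by \<open>V\<close>, so each Penrose condition is inherited from
  the one for \<open>D\<close> and \<open>X\<close>.\<close>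

lemma is_pseudo_inverse_orthogonal_equivalence:
  assumes "real_orthogonal_mat n U" "real_orthogonal_mat p V"
    and "D \<in> carrier_mat n p" "is_pseudo_inverse D X"
  shows "is_pseudo_inverse (U * D * transpose_mat V) (V * X * transpose_mat U)"
proof -
  have U: "U \<in> carrier_mat n n" "transpose_mat U * U = 1\<^sub>m n"
    and V: "V \<in> carrier_mat p p" "transpose_mat V * V = 1\<^sub>m p"
    using assms by (auto simp: real_orthogonal_mat_def)
  have D: "D \<in> carrier_mat n p" by fact
  have X: "X \<in> carrier_mat p n"
    and eqs: "D * X * D = D" "X * D * X = X"
      "transpose_mat (D * X) = D * X" "transpose_mat (X * D) = X * D"
    using assms by (auto simp: is_pseudo_inverse_def)
  have DX: "D * X \<in> carrier_mat n n" and XD: "X * D \<in> carrier_mat p p"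
    using D X by auto
  have AB: "(U * D * transpose_mat V) * (V * X * transpose_mat U) = U * (D * X) * transpose_mat U"
    by (rule mult_orthogonal_cancel[OF U(1) D V(1) X U(1) V(2)])
  have BA: "(V * X * transpose_mat U) * (U * D * transpose_mat V) = V * (X * D) * transpose_mat V"
    by (rule mult_orthogonal_cancel[OF V(1) X U(1) D V(1) U(2)])
  show ?thesis
    unfolding is_pseudo_inverse_def AB BA
      mult_orthogonal_cancel[OF U(1) DX U(1) D V(1) U(2)]
      mult_orthogonal_cancel[OF V(1) XD V(1) X U(1) V(2)]
      transpose_mult3[OF U(1) DX U(1)] transpose_mult3[OF V(1) XD V(1)] eqs
    using U V D X by auto
qed

section \<open>Rank of a singular value decomposition\<close>

text \<open>Every combination of columns of \<open>A * W\<close> is \<open>A\<close> applied to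
  \<open>W *\<^sub>v x\<close>. Used in both directions, this shows that two matrices have equal
  column spaces.\<close>

lemma (in vec_space) col_space_mult_subset:
  assumes A: "A \<in> carrier_mat n k" and W: "W \<in> carrier_mat k m"
  shows "span (set (cols (A * W))) \<subseteq> span (set (cols A))"
proof -
  have "col_space (A * W) \<subseteq> col_space A"
    unfolding col_space_eq[OF A] col_space_eq[OF mult_carrier_mat[OF A W]]
  proof safe
    fix x assume x: "(x :: 'a vec) \<in> carrier_vec (dim_col (A * W))"
    with A W have "A * W *\<^sub>v x = A *\<^sub>v (W *\<^sub>v x)" "W *\<^sub>v x \<in> carrier_vec (dim_col A)"
      by (auto intro: assoc_mult_mat_vec)
    then show "\<exists>y\<in>carrier_vec (dim_col A). A *\<^sub>v y = A * W *\<^sub>v x" by metis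
  qed auto
  then show ?thesis by (simp add: col_space_def)
qed

lemma mult_unit_vec:
  fixes A :: "'a :: semiring_1 mat"
  assumes "A \<in> carrier_mat n k" "j < k"
  shows "A *\<^sub>v unit_vec k j = col A j"
  using assms by (intro eq_vecI) auto

text \<open>A left inverse makes \<open>C\<close> injective on vectors, so its kernel is trivial and
  its columns are independent.\<close>

lemma (in vec_space) rank_left_invertible:
  assumes C: "C \<in> carrier_mat n k" and L: "L \<in> carrier_mat k n" and LC: "L * C = 1\<^sub>m k"
  shows "rank C = k"
proof -
  have inj: "x = y" if "x \<in> carrier_vec k" "y \<in> carrier_vec k" "C *\<^sub>v x = C *\<^sub>v y" for x y
  proof -
    have "L * C *\<^sub>v x = L * C *\<^sub>v y"
      using that C L by (simp add: assoc_mult_mat_vec[OF L C])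
    then show ?thesis using that by (simp add: LC)
  qed
  \<comment> \<open>\<open>set (cols C)\<close> merges equal columns, so independence of that set
    alone would not give rank \<open>k\<close>. Columns are images of distinct unit vectors.\<close>
  have dist: "distinct (cols C)"
  proof (unfold distinct_conv_nth, intro allI impI)
    fix i j assume "i < length (cols C)" "j < length (cols C)" and ne: "i \<noteq> j"
    then have ij: "i < k" "j < k" using C by auto
    have "unit_vec k i \<noteq> (unit_vec k j :: 'a vec)"
      using ij ne by (simp add: unit_vec_eq)
    then have "C *\<^sub>v unit_vec k i \<noteq> C *\<^sub>v unit_vec k j"
      using inj by force
    then show "cols C ! i \<noteq> cols C ! j"
      using ij C by (simp add: mult_unit_vec)
  qed
  have "lin_indpt (set (cols C))"
  proof -
    have False if v: "v \<in> carrier_vec k" "v \<noteq> 0\<^sub>v k" "C *\<^sub>v v = 0\<^sub>v n" for v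
    proof -
      have "C *\<^sub>v 0\<^sub>v k = 0\<^sub>v n" using C by (intro eq_vecI) auto
      with inj[of v "0\<^sub>v k"] v show False by simp
    qed
    then show ?thesis using lin_depE[OF C _ dist] by blast
  qed
  then show ?thesis by (rule lin_indpt_full_rank[OF C dist])
qed

text \<open>\<open>Z\<close> recovers \<open>C\<close> from \<open>C * W\<close>, so multiplying by
  \<open>W\<close> does not shrink the column space of \<open>C\<close>.\<close>

lemma (in vec_space) rank_full_rank_factor:
  assumes C: "C \<in> carrier_mat n k" and W: "W \<in> carrier_mat k m"
    and Z: "Z \<in> carrier_mat m k" and L: "L \<in> carrier_mat k n"
    and CWZ: "C * W * Z = C" and LC: "L * C = 1\<^sub>m k"
  shows "rank (C * W) = k"
proof -
  have "span (set (cols (C * W))) = span (set (cols C))"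
    using col_space_mult_subset[OF C W] col_space_mult_subset[OF mult_carrier_mat[OF C W] Z]
    by (auto simp: CWZ)
  then show ?thesis using rank_left_invertible[OF C L LC] by (simp add: rank_def)
qed

text \<open>The \<open>k\<close> nonzero singular values give a factorization through dimension
  \<open>k\<close> whose left factor has orthonormal columns.\<close>

lemma rank_svd_rect_diag:
  fixes d :: "nat \<Rightarrow> real"
  assumes U: "real_orthogonal_mat n U" and V: "real_orthogonal_mat p V"
    and k: "k \<le> n" "k \<le> p"
    and d: "\<And>i. i < n \<Longrightarrow> i < p \<Longrightarrow> d i = 0 \<longleftrightarrow> k \<le> i"
  shows "vec_space.rank n (U * rect_diag n p d * transpose_mat V) = k"
proof -
  let ?I = "1\<^sub>m k :: real mat"
  \<comment> \<open>For i < k, with u and v denoting columns of \<open>U\<close> and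
    \<open>V\<close>: \<open>C\<close> has the columns u_i, \<open>W\<close> the rows d_i v_i^T,
    \<open>Z\<close> the columns v_i / d_i, and \<open>L\<close> is the transpose of
    \<open>C\<close>. The factor \<open>?I\<close> brings all four into the form required by
    \<open>mult_orthogonal_cancel\<close>.\<close>
  define C where "C = U * rect_diag n k (\<lambda>_. 1) * transpose_mat ?I"
  define W where "W = ?I * rect_diag k p d * transpose_mat V"
  define Z where "Z = V * rect_diag p k (\<lambda>i. inverse (d i)) * transpose_mat ?I"
  define L where "L = ?I * rect_diag k n (\<lambda>_. 1) * transpose_mat U"
  have Uc: "U \<in> carrier_mat n n" "transpose_mat U * U = 1\<^sub>m n"
    and Vc: "V \<in> carrier_mat p p" "transpose_mat V * V = 1\<^sub>m p"
    using U V by (auto simp: real_orthogonal_mat_def)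
  have I: "?I \<in> carrier_mat k k" "transpose_mat ?I * ?I = 1\<^sub>m k" by auto
  have carriers: "C \<in> carrier_mat n k" "W \<in> carrier_mat k p" "Z \<in> carrier_mat p k"
      "L \<in> carrier_mat k n"
    using Uc Vc by (auto simp: C_def W_def Z_def L_def)
  have CW: "C * W = U * rect_diag n p d * transpose_mat V"
  proof -
    have "C * W = U * (rect_diag n k (\<lambda>_. 1) * rect_diag k p d) * transpose_mat V"
      unfolding C_def W_def
      by (rule mult_orthogonal_cancel[OF Uc(1) _ I(1) _ Vc(1) I(2)]) auto
    also have "rect_diag n k (\<lambda>_. 1) * rect_diag k p d = rect_diag n p d"
      using d by (auto simp: rect_diag_mult intro!: rect_diag_cong)
    finally show ?thesis .
  qed
  have CWZ: "C * W * Z = C"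
  proof -
    have "C * W * Z = U * (rect_diag n p d * rect_diag p k (\<lambda>i. inverse (d i))) * transpose_mat ?I"
      unfolding CW Z_def
      by (rule mult_orthogonal_cancel[OF Uc(1) _ Vc(1) _ I(1) Vc(2)]) auto
    also have "rect_diag n p d * rect_diag p k (\<lambda>i. inverse (d i)) = rect_diag n k (\<lambda>_. 1)"
      using d k by (auto simp: rect_diag_mult intro!: rect_diag_cong)
    finally show ?thesis by (simp add: C_def)
  qed
  have LC: "L * C = 1\<^sub>m k"
  proof -
    have "L * C = ?I * (rect_diag k n (\<lambda>_. 1) * rect_diag n k (\<lambda>_. 1)) * transpose_mat ?I"
      unfolding C_def L_def
      by (rule mult_orthogonal_cancel[OF I(1) _ Uc(1) _ I(1) Uc(2)]) auto
    also have "rect_diag k n (\<lambda>_. 1) * rect_diag n k (\<lambda>_. 1) = ?I"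
      using k by (auto simp: rect_diag_mult rect_diag_one intro!: rect_diag_cong)
    finally show ?thesis by simp
  qed
  show ?thesis
    using vec_space.rank_full_rank_factor[OF carriers CWZ LC] by (simp add: CW)
qed

text \<open>Nonnegative decreasing entries vanish from the first zero onwards, and the position of
  that zero is the rank by \<open>rank_svd_rect_diag\<close>.\<close>

lemma svd_zero_iff_rank_le:
  assumes B: "B \<in> carrier_mat n p" and svd: "is_svd B U D V"
    and r: "vec_space.rank n B = r"
  shows "r \<le> p" "\<And>i. i < n \<Longrightarrow> i < p \<Longrightarrow> D $$ (i, i) = 0 \<longleftrightarrow> r \<le> i"
proof -
  have U: "real_orthogonal_mat n U" and V: "real_orthogonal_mat p V"
    and D: "D \<in> carrier_mat n p" "diagonal_mat D"
    and nonneg: "\<And>i. i < min n p \<Longrightarrow> 0 \<le> D $$ (i, i)"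
    and decr: "\<And>i j. i \<le> j \<Longrightarrow> j < min n p \<Longrightarrow> D $$ (j, j) \<le> D $$ (i, i)"
    and BD: "B = U * D * transpose_mat V"
    using svd B by (auto simp: is_svd_def)
  \<comment> \<open>The alternative \<open>i = min n p\<close> provides a value when no diagonal
    entry is zero.\<close>
  define k where "k = (LEAST i. i = min n p \<or> D $$ (i, i) = 0)"
  have k: "k = min n p \<or> D $$ (k, k) = 0" "k \<le> min n p"
    unfolding k_def by (rule LeastI[of _ "min n p"], simp) (rule Least_le, simp)
  have iff: "D $$ (i, i) = 0 \<longleftrightarrow> k \<le> i" if "i < n" "i < p" for i
  proof
    assume "D $$ (i, i) = 0"
    then show "k \<le> i" unfolding k_def by (simp add: Least_le)
  next
    assume "k \<le> i"
    then show "D $$ (i, i) = 0" using decr[of k i] nonneg[of i] k that by auto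
  qed
  have "r = k"
    using rank_svd_rect_diag[OF U V, of k "\<lambda>i. D $$ (i, i)"] iff k r
    by (simp add: BD flip: diagonal_mat_eq_rect_diag[OF D(2,1)])
  with k iff show "r \<le> p" "\<And>i. i < n \<Longrightarrow> i < p \<Longrightarrow> D $$ (i, i) = 0 \<longleftrightarrow> r \<le> i"
    by auto
qed

section \<open>Augmented matrices\<close>

lemma drop_cols_carrier:
  "A \<in> carrier_mat n m \<Longrightarrow> drop_cols r A \<in> carrier_mat n (m - r)"
  by (auto simp: drop_cols_def mat_of_cols_def)

lemma index_drop_cols:
  "i < dim_row A \<Longrightarrow> r + j < dim_col A \<Longrightarrow> drop_cols r A $$ (i, j) = A $$ (i, r + j)"
  by (simp add: drop_cols_def mat_of_cols_index)

lemma drop_cols_mult: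
  assumes A: "A \<in> carrier_mat n m" and B: "B \<in> carrier_mat m k"
  shows "drop_cols r (A * B) = A * drop_cols r B"
proof (rule eq_matI)
  note c = drop_cols_carrier[OF mult_carrier_mat[OF A B], of r] drop_cols_carrier[OF B, of r]
  show "dim_row (drop_cols r (A * B)) = dim_row (A * drop_cols r B)"
    "dim_col (drop_cols r (A * B)) = dim_col (A * drop_cols r B)"
    using A B c by auto
  fix i j assume "i < dim_row (A * drop_cols r B)" "j < dim_col (A * drop_cols r B)"
  then have ij: "i < n" "r + j < k" using A B c by auto
  then have "drop_cols r (A * B) $$ (i, j) = row A i \<bullet> col B (r + j)"
    using A B by (simp add: index_drop_cols)
  also have "col B (r + j) = col (drop_cols r B) j"
    using ij B c by (intro eq_vecI) (auto simp: index_drop_cols)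
  finally show "drop_cols r (A * B) $$ (i, j) = (A * drop_cols r B) $$ (i, j)"
    using ij A c by auto
qed

lemma drop_cols_one_gram:
  "drop_cols r (1\<^sub>m n) * transpose_mat (drop_cols r (1\<^sub>m n :: 'a :: comm_ring_1 mat)) =
     rect_diag n n (\<lambda>i. if i < r then 0 else 1)" (is "?E * _ = ?R")
proof (rule eq_matI)
  have E: "?E \<in> carrier_mat n (n - r)" by (rule drop_cols_carrier) simp
  then show "dim_row (?E * transpose_mat ?E) = dim_row ?R"
    "dim_col (?E * transpose_mat ?E) = dim_col ?R" by auto
  fix i j assume "i < dim_row ?R" "j < dim_col ?R"
  then have ij: "i < n" "j < n" by auto
  have "(?E * transpose_mat ?E) $$ (i, j) = (\<Sum>k = 0..<n - r. ?E $$ (i, k) * ?E $$ (j, k))"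
    using E ij by (simp add: scalar_prod_def)
  \<comment> \<open>Column k of \<open>?E\<close> is the unit vector with index r + k, so only k = i
    - r can contribute. The condition \<open>r \<le> i\<close> excludes the truncated difference 0
    that arises for i < r.\<close>
  also have "\<dots> = (\<Sum>k = 0..<n - r. if k = i - r then (if i = j \<and> r \<le> i then 1 else 0) else 0)"
    using ij by (intro sum.cong) (auto simp: index_drop_cols)
  also have "\<dots> = ?R $$ (i, j)"
    using ij by (auto simp: rect_diag_def)
  finally show "(?E * transpose_mat ?E) $$ (i, j) = ?R $$ (i, j)" .
qed

text \<open>Dropping columns of \<open>U\<close> is multiplication of \<open>U\<close> by the
  truncated identity. This gives the appended block the same outer factors as
  \<open>B * transpose_mat B\<close>, so that the two can be added on the diagonal.\<close>

lemma drop_cols_gram: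
  fixes U :: "'a :: comm_ring_1 mat"
  assumes U: "U \<in> carrier_mat n n"
  shows "drop_cols r U * transpose_mat (drop_cols r U) =
    U * rect_diag n n (\<lambda>i. if i < r then 0 else 1) * transpose_mat U"
proof -
  let ?E = "drop_cols r (1\<^sub>m n) :: 'a mat"
  have E: "?E \<in> carrier_mat n (n - r)" by (rule drop_cols_carrier) simp
  have "drop_cols r U = U * ?E" using drop_cols_mult[OF U one_carrier_mat] U by simp
  then show ?thesis
    using U E
    by (simp add: transpose_mult_dim assoc_mult_mat_dim
        flip: drop_cols_one_gram)
qed

lemma append_cols_carrier:
  "A \<in> carrier_mat n p \<Longrightarrow> B \<in> carrier_mat n q \<Longrightarrow> A @\<^sub>c B \<in> carrier_mat n (p + q)"
  by (auto simp: append_cols_def)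

text \<open>Gram entries are inner products of rows, and the rows here are concatenations, so each
  inner product splits in two.\<close>

lemma append_cols_gram:
  fixes A B :: "'a :: comm_ring_1 mat"
  assumes A: "A \<in> carrier_mat n p" and B: "B \<in> carrier_mat n q"
  shows "(A @\<^sub>c B) * transpose_mat (A @\<^sub>c B) = A * transpose_mat A + B * transpose_mat B"
proof (rule eq_matI)
  have AB: "A @\<^sub>c B \<in> carrier_mat n (p + q)" by (rule append_cols_carrier[OF A B])
  then show "dim_row ((A @\<^sub>c B) * transpose_mat (A @\<^sub>c B)) =
      dim_row (A * transpose_mat A + B * transpose_mat B)"
    "dim_col ((A @\<^sub>c B) * transpose_mat (A @\<^sub>c B)) =
      dim_col (A * transpose_mat A + B * transpose_mat B)"
    using A B by auto
  have row: "row (A @\<^sub>c B) i = row A i @\<^sub>v row B i" if "i < n" for i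
    using that A B unfolding append_cols_def
    by (subst row_four_block_mat[of _ n p _ q _ 0]) auto
  fix i j assume "i < dim_row (A * transpose_mat A + B * transpose_mat B)"
    "j < dim_col (A * transpose_mat A + B * transpose_mat B)"
  then have ij: "i < n" "j < n" using A B by auto
  have "((A @\<^sub>c B) * transpose_mat (A @\<^sub>c B)) $$ (i, j) = row (A @\<^sub>c B) i \<bullet> row (A @\<^sub>c B) j"
    using ij AB by simp
  also have "\<dots> = row A i \<bullet> row A j + row B i \<bullet> row B j"
    unfolding row[OF ij(1)] row[OF ij(2)]
    using A B ij by (intro scalar_prod_append[of _ p _ q]) auto
  also have "\<dots> = (A * transpose_mat A + B * transpose_mat B) $$ (i, j)"
    using ij A B by simp
  finally show "((A @\<^sub>c B) * transpose_mat (A @\<^sub>c B)) $$ (i, j) =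
      (A * transpose_mat A + B * transpose_mat B) $$ (i, j)" .
qed

lemma take_rows_transpose_append_cols_mult:
  fixes A B X :: "'a :: comm_ring_1 mat"
  assumes A: "A \<in> carrier_mat n p" and B: "B \<in> carrier_mat n q" and X: "X \<in> carrier_mat n m"
  shows "take_rows p (transpose_mat (A @\<^sub>c B) * X) = transpose_mat A * X"
proof (rule eq_matI)
  have AB: "A @\<^sub>c B \<in> carrier_mat n (p + q)" by (rule append_cols_carrier[OF A B])
  then show "dim_row (take_rows p (transpose_mat (A @\<^sub>c B) * X)) = dim_row (transpose_mat A * X)"
    "dim_col (take_rows p (transpose_mat (A @\<^sub>c B) * X)) = dim_col (transpose_mat A * X)"
    using A X by (auto simp: take_rows_def)
  fix i j assume "i < dim_row (transpose_mat A * X)" "j < dim_col (transpose_mat A * X)"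
  then have ij: "i < p" "j < m" using A X by auto
  have "col (A @\<^sub>c B) i = col A i"
    using ij A B AB by (intro eq_vecI) (auto simp: append_cols_def)
  then show "take_rows p (transpose_mat (A @\<^sub>c B) * X) $$ (i, j) = (transpose_mat A * X) $$ (i, j)"
    using ij A X AB by (simp add: take_rows_def mat_of_rows_index)
qed

text \<open>A two-sided inverse rules out \<open>None\<close>, and uniqueness of inverses identifies
  the result. This evaluates the term \<open>the (mat_inverse ...)\<close> in the theorem.\<close>

lemma mat_inverse_eqI:
  fixes A :: "'a :: field mat"
  assumes A: "A \<in> carrier_mat n n" and X: "X \<in> carrier_mat n n"
    and AX: "A * X = 1\<^sub>m n" and XA: "X * A = 1\<^sub>m n"
  shows "mat_inverse A = Some X"
proof (cases "mat_inverse A")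
  case None
  then have "A \<notin> Units (ring_mat TYPE('a) n ())" by (rule mat_inverse(1)[OF A])
  with A X AX XA show ?thesis by (auto simp: Units_def ring_mat_simps)
next
  case (Some Y)
  from mat_inverse(2)[OF A Some] have Y: "Y * A = 1\<^sub>m n" "Y \<in> carrier_mat n n" by auto
  have "Y = Y * (A * X)" using Y AX by simp
  also have "\<dots> = Y * A * X" using assoc_mult_mat[OF Y(2) A X] by simp
  also have "\<dots> = X" using Y X by simp
  finally show ?thesis using Some by simp
qed

theorem theorem2:
  fixes B U D V B_aug P B_dagger :: "real mat" and n p r :: nat
  assumes "B \<in> carrier_mat n p"
    and "vec_space.rank n B = r" and "r < n"
    and "is_svd B U D V"
    and "B_aug = B @\<^sub>c drop_cols r U"
    and "P = transpose_mat B_aug * the (mat_inverse (B_aug * transpose_mat B_aug))"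
    and "B_dagger = take_rows p P"
  shows "invertible_mat (B_aug * transpose_mat B_aug) \<and> is_pseudo_inverse B B_dagger"
proof -
  have U: "real_orthogonal_mat n U" and V: "real_orthogonal_mat p V"
    and "D \<in> carrier_mat n p" "diagonal_mat D" and BD: "B = U * D * transpose_mat V"
    using assms(1,4) by (auto simp: is_svd_def)
  define d where "d = (\<lambda>i. D $$ (i, i))"
  have D: "D = rect_diag n p d"
    unfolding d_def by (rule diagonal_mat_eq_rect_diag) fact+
  have r: "r \<le> p" "\<And>i. i < n \<Longrightarrow> i < p \<Longrightarrow> d i = 0 \<longleftrightarrow> r \<le> i"
    using svd_zero_iff_rank_le[OF assms(1,4,2)] by (auto simp: d_def)
  have Uc: "U \<in> carrier_mat n n" "transpose_mat U * U = 1\<^sub>m n" "U * transpose_mat U = 1\<^sub>m n"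
    and Vc: "V \<in> carrier_mat p p" "transpose_mat V * V = 1\<^sub>m p"
    using U V by (auto simp: real_orthogonal_mat_def)
  have BT: "transpose_mat B = V * rect_diag p n d * transpose_mat U"
    unfolding BD D by (simp add: transpose_mult3[OF Uc(1) _ Vc(1)])
  define s where "s = (\<lambda>i. if i < r then d i * d i else 1)"
  define M where "M = B_aug * transpose_mat B_aug"
  define N where "N = U * rect_diag n n (\<lambda>i. inverse (s i)) * transpose_mat U"
  \<comment> \<open>For i < r the bound \<open>r \<le> p\<close> puts i on the diagonal of
    \<open>D\<close>, where \<open>d i\<close> is nonzero.\<close>
  have s: "s i \<noteq> 0" if "i < n" for i
    using r that by (auto simp: s_def)
  have M: "M = U * rect_diag n n s * transpose_mat U"
  proof -
    have "M = B * transpose_mat B + drop_cols r U * transpose_mat (drop_cols r U)"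
      unfolding M_def assms(5)
      by (rule append_cols_gram[OF assms(1) drop_cols_carrier[OF Uc(1)]])
    also have "B * transpose_mat B = U * (rect_diag n p d * rect_diag p n d) * transpose_mat U"
      unfolding BT unfolding BD D
      by (rule mult_orthogonal_cancel[OF Uc(1) _ Vc(1) _ Uc(1) Vc(2)]) auto
    also have "\<dots> + drop_cols r U * transpose_mat (drop_cols r U) =
        U * (rect_diag n p d * rect_diag p n d + rect_diag n n (\<lambda>i. if i < r then 0 else 1)) *
        transpose_mat U"
      unfolding drop_cols_gram[OF Uc(1)] using Uc(1)
      by (simp add: rect_diag_mult mult_add_distrib_mat[of _ n n _ n]
          add_mult_distrib_mat[of _ n n _ _ n])
    \<comment> \<open>From r onwards the first summand is zero, either because
      \<open>d i = 0\<close> or because i lies beyond \<open>p\<close>; there the second summand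
      contributes 1.\<close>
    also have "rect_diag n p d * rect_diag p n d + rect_diag n n (\<lambda>i. if i < r then 0 else 1) =
        rect_diag n n s"
      using r by (auto simp: rect_diag_mult rect_diag_add s_def intro!: rect_diag_cong)
    finally show ?thesis .
  qed
  have carriers: "M \<in> carrier_mat n n" "N \<in> carrier_mat n n"
    using Uc(1) by (auto simp: M N_def)
  have one: "U * 1\<^sub>m n * transpose_mat U = 1\<^sub>m n" using Uc by simp
  have MN: "M * N = 1\<^sub>m n"
  proof -
    have "M * N = U * (rect_diag n n s * rect_diag n n (\<lambda>i. inverse (s i))) * transpose_mat U"
      unfolding M N_def by (rule mult_orthogonal_cancel[OF Uc(1) _ Uc(1) _ Uc(1,2)]) auto
    also have "rect_diag n n s * rect_diag n n (\<lambda>i. inverse (s i)) = 1\<^sub>m n"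
      unfolding rect_diag_one rect_diag_mult using s by (intro rect_diag_cong) auto
    finally show ?thesis using one by simp
  qed
  then have NM: "N * M = 1\<^sub>m n"
    by (rule mat_mult_left_right_inverse[OF carriers])
  have "invertible_mat M"
    unfolding invertible_mat_def inverts_mat_def using carriers MN NM by auto
  moreover have "B_dagger = V * rect_diag p n (\<lambda>i. inverse (d i)) * transpose_mat U"
  proof -
    have "P = transpose_mat B_aug * N"
      unfolding assms(6) M_def[symmetric] using mat_inverse_eqI[OF carriers MN NM] by simp
    then have "B_dagger = transpose_mat B * N"
      unfolding assms(7,5)
      using take_rows_transpose_append_cols_mult[OF assms(1) drop_cols_carrier[OF Uc(1)] carriers(2)]
      by simp
    also have "\<dots> = V * (rect_diag p n d * rect_diag n n (\<lambda>i. inverse (s i))) * transpose_mat U"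
      unfolding BT N_def by (rule mult_orthogonal_cancel[OF Vc(1) _ Uc(1) _ Uc(1,2)]) auto
    \<comment> \<open>For i < r this is d / d^2 = 1 / d. Otherwise \<open>d i = 0\<close> and
      \<open>s i = 1\<close>, and both sides are 0 since \<open>inverse 0 = 0\<close>.\<close>
    also have "rect_diag p n d * rect_diag n n (\<lambda>i. inverse (s i)) =
        rect_diag p n (\<lambda>i. inverse (d i))"
      unfolding rect_diag_mult by (intro rect_diag_cong) (use r(2) in \<open>force simp: s_def not_less\<close>)
    finally show ?thesis .
  qed
  ultimately show ?thesis
    using is_pseudo_inverse_orthogonal_equivalence[OF U V _ is_pseudo_inverse_rect_diag]
    by (simp add: M_def BD D)
qed

end
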